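(* Suppose that $|F_n(t)| \leq \frac{2}{e}$ holds for all integers $n$ with $1 \leq n \leq 21138$ and all real $t > 0$. Then $|F_n(t)| \leq \frac{2}{e}$ holds for all integers $n \geq 1$ and all real $t > 0$.
   Context: The functions $F_k$ ($k \in \{0,1,2,\ldots\}$, called Bateman functions) are defined for $t \geq 0$ as the Taylor coefficients, for $z$ in the open unit disk of $\mathbb{C}$, in the generating function $$e^{-t\,\frac{1+z}{1-z}} = \sum_{k=0}^{\infty} F_k(t)\, z^k .$$ Here $e$ is Euler's number. *)

theory Defs
  imports "HOL-Complex_Analysis.Complex_Analysis"
begin

definition bateman_gf :: "real \<Rightarrow> complex \<Rightarrow> complex" where
  "bateman_gf t z = exp (- of_real t * ((1 + z) / (1 - z)))"

text \<open>
  The Taylor coefficients at 0 of the generating function are real, so taking the real part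
  loses nothing; this is justified by \<open>bateman_sums\<close> below, and \<open>bateman_unique\<close> shows that
  the expansion in the unit disk determines the coefficients.
\<close>

definition bateman :: "nat \<Rightarrow> real \<Rightarrow> real" where
  "bateman k t = Re ((deriv ^^ k) (bateman_gf t) 0 / fact k)"

lemma bateman_sums:
  assumes "norm z < 1"
  shows "(\<lambda>k. of_real (bateman k t) * z ^ k) sums bateman_gf t z"
proof -
  define c where "c k = (deriv ^^ k) (bateman_gf t) 0 / fact k" for k
  have hol: "bateman_gf t holomorphic_on ball 0 1"
    unfolding bateman_gf_def by (intro holomorphic_intros) auto
  have sums: "(\<lambda>k. c k * w ^ k) sums bateman_gf t w" if "norm w < 1" for w
    using holomorphic_power_series[OF hol, of w] that by (simp add: c_def)
  have "(\<lambda>k. cnj (c k * cnj z ^ k)) sums cnj (bateman_gf t (cnj z))"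
    by (subst sums_cnj) (rule sums, use assms in simp)
  hence "(\<lambda>k. cnj (c k) * z ^ k) sums bateman_gf t z"
    by (simp add: bateman_gf_def exp_cnj)
  from sums_mult[OF sums_add[OF sums[OF assms] this], of "1/2"]
  have "(\<lambda>k. ((c k + cnj (c k)) / 2) * z ^ k) sums bateman_gf t z"
    by (simp add: add_divide_distrib ring_distribs)
  moreover have "(c k + cnj (c k)) / 2 = of_real (bateman k t)" for k
    by (simp add: complex_add_cnj bateman_def flip: c_def)
  ultimately show ?thesis by simp
qed

lemma bateman_unique:
  fixes a :: "nat \<Rightarrow> complex"
  assumes "\<And>z. norm z < 1 \<Longrightarrow> (\<lambda>k. a k * z ^ k) sums bateman_gf t z"
  shows "a k = of_real (bateman k t)"
proof -
  have ev: "eventually (\<lambda>z. norm z < 1) (nhds (0::complex))"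
    using eventually_nhds_in_open[of "ball 0 1" "0::complex"] by simp
  have "bateman_gf t has_fps_expansion Abs_fps a"
    by (rule has_fps_expansionI, rule eventually_mono[OF ev]) (simp add: assms)
  moreover have "bateman_gf t has_fps_expansion Abs_fps (\<lambda>k. of_real (bateman k t))"
    by (rule has_fps_expansionI, rule eventually_mono[OF ev]) (simp add: bateman_sums)
  ultimately have "Abs_fps a = Abs_fps (\<lambda>k. of_real (bateman k t))"
    by (rule fps_expansion_unique_complex)
  thus ?thesis by (metis fps_nth_Abs_fps)
qed

end

theory Submission
  imports Defs
begin

text \<open>
  Write \<open>F\<close> for the \<open>n\<close>-th Bateman function. It solves \<open>F'' = (1 - 2n/t) F\<close>, so the energy
  \<open>E = F'\<^sup>2 + (2n/t - 1) F\<^sup>2\<close> satisfies \<open>E' = -2n F\<^sup>2 / t\<^sup>2\<close> and vanishes at infinity. Since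
  the total mass \<open>n \<integral> F\<^sup>2 / s ds\<close> over \<open>(0, \<infinity>)\<close> is 1 (Laguerre norm), this gives
  \<open>E(t) \<le> 2 / t\<close> for all \<open>t > 0\<close>. Hence \<open>F\<^sup>2 \<le> 2 / (2n - t)\<close> to the left of the turning point
  \<open>2n\<close>, which is good enough up to distance 10 from it; on the remaining stretch the energy
  bound gives \<open>\<bar>F'\<bar> \<le> sqrt (2 / t)\<close>, which is tiny for large \<open>n\<close>; beyond \<open>2n\<close> the function
  \<open>\<bar>F\<bar>\<close> decreases.
\<close>

section \<open>A bound from the differential equation and the mass\<close>

text \<open>Stands in for integration from \<open>a\<close> to infinity: the sign of the derivative
  and the limit 0 fix the sign of \<open>h a\<close>.\<close>

lemma nonneg_if_decreasing_to_0:
  fixes h h' :: "real \<Rightarrow> real"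
  assumes deriv: "\<And>s. a \<le> s \<Longrightarrow> (h has_real_derivative h' s) (at s)"
    and nonpos: "\<And>s. a \<le> s \<Longrightarrow> h' s \<le> 0"
    and lim: "(h \<longlongrightarrow> 0) at_top"
  shows "0 \<le> h a"
proof (rule tendsto_upperbound[OF lim])
  have "h s \<le> h a" if "a \<le> s" for s
    by (rule DERIV_nonpos_imp_nonincreasing[where f = h, OF that]) (use deriv nonpos in blast)
  thus "eventually (\<lambda>s. h s \<le> h a) at_top"
    by (rule eventually_mono[OF eventually_ge_at_top])
qed simp

text \<open>In the variable 2 t the equation is Whittaker's, with kappa = \<open>N\<close> and mu =
  1/2. \<open>P\<close> is the tail mass, the integral of \<open>N * (f s)^2 / s\<close> over s > t,
  pinned down by its derivative and its limit at infinity; \<open>lim_P_0\<close> sets the total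
  mass to 1.\<close>

locale whittaker_mass =
  fixes f g P :: "real \<Rightarrow> real" and N :: real
  assumes deriv_f: "0 < t \<Longrightarrow> (f has_real_derivative g t) (at t)"
    and deriv_g: "0 < t \<Longrightarrow> (g has_real_derivative (1 - 2 * N / t) * f t) (at t)"
    and deriv_P: "0 < t \<Longrightarrow> (P has_real_derivative - (N * (f t)\<^sup>2 / t)) (at t)"
    and lim_f: "(f \<longlongrightarrow> 0) at_top"
    and lim_g: "(g \<longlongrightarrow> 0) at_top"
    and lim_P: "(P \<longlongrightarrow> 0) at_top"
    and lim_P_0: "(P \<longlongrightarrow> 1) (at_right 0)"
    and N_pos: "0 < N"
begin

lemma P_nonneg: "0 \<le> P t" if "0 < t"
proof (rule nonneg_if_decreasing_to_0[OF _ _ lim_P])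
  fix s assume "t \<le> s"
  with that have "0 < s" by simp
  thus "(P has_real_derivative - (N * (f s)\<^sup>2 / s)) (at s)" "- (N * (f s)\<^sup>2 / s) \<le> 0"
    using deriv_P N_pos by auto
qed

lemma P_le_1: "P t \<le> 1" if "0 < t"
proof (rule tendsto_lowerbound[OF lim_P_0])
  have "P t \<le> P s" if s: "s \<in> {0<..<t}" for s
  proof (rule DERIV_nonpos_imp_nonincreasing[where f = P])
    fix x assume "s \<le> x" "x \<le> t"
    with s have "0 < x" by simp
    thus "\<exists>y. (P has_real_derivative y) (at x) \<and> y \<le> 0"
      using deriv_P[of x] N_pos by (intro exI[of _ "- (N * (f x)\<^sup>2 / x)"]) auto
  qed (use s in simp)
  moreover have "eventually (\<lambda>s. s \<in> {0<..<t}) (at_right 0)"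
    using eventually_at_right_real[OF that] .
  ultimately show "eventually (\<lambda>s. P t \<le> P s) (at_right 0)"
    by (auto elim: eventually_mono)
qed simp

lemma energy_le: "(g t)\<^sup>2 + (2 * N / t - 1) * (f t)\<^sup>2 \<le> 2 / t" if "0 < t"
proof -
  \<comment> \<open>The factor \<open>2 / s\<close> is chosen so that the part of the derivative
    coming from \<open>P\<close> cancels the derivative of the energy; only
    \<open>- 2 * P s / s^2\<close> survives.\<close>
  define D where "D s = 2 * P s / s - ((g s)\<^sup>2 + (2 * N / s - 1) * (f s)\<^sup>2)" for s
  have "0 \<le> D t"
  proof (rule nonneg_if_decreasing_to_0[where h = D])
    fix s assume "t \<le> s"
    with that have s: "0 < s" "s \<noteq> 0" by auto
    show "(D has_real_derivative - 2 * P s / s\<^sup>2) (at s)"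
      unfolding D_def
      apply (rule derivative_eq_intros deriv_f deriv_g deriv_P s refl)+
      using s by (simp add: field_simps power2_eq_square)
    show "- 2 * P s / s\<^sup>2 \<le> 0"
      using P_nonneg[OF s(1)] by (simp add: field_simps)
  next
    have inv: "((\<lambda>s::real. 1 / s) \<longlongrightarrow> 0) at_top"
      by (simp add: divide_inverse tendsto_inverse_0_at_top filterlim_ident)
    have "((\<lambda>s. 2 * P s * (1 / s) - ((g s)\<^sup>2 + (2 * N * (1 / s) - 1) * (f s)\<^sup>2))
            \<longlongrightarrow> 2 * 0 * 0 - (0\<^sup>2 + (2 * N * 0 - 1) * 0\<^sup>2)) at_top"
      by (intro tendsto_intros lim_P lim_f lim_g inv)
    thus "(D \<longlongrightarrow> 0) at_top"
      by (simp add: D_def[abs_def])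
  qed
  moreover have "2 * P t / t \<le> 2 / t"
    using P_le_1[OF that] that by (simp add: divide_right_mono)
  ultimately show ?thesis
    by (simp add: D_def)
qed

lemma square_le: "(f t)\<^sup>2 \<le> 2 / (2 * N - t)" if "0 < t" "t < 2 * N"
proof -
  have "(2 * N / t - 1) * (f t)\<^sup>2 \<le> 2 / t"
    using energy_le[OF that(1)] zero_le_power2[of "g t"] by linarith
  hence "t * ((2 * N / t - 1) * (f t)\<^sup>2) \<le> t * (2 / t)"
    using that(1) by (intro mult_left_mono) auto
  moreover have "t * ((2 * N / t - 1) * (f t)\<^sup>2) = (2 * N - t) * (f t)\<^sup>2"
    using that(1) by (simp add: field_simps)
  moreover have "t * (2 / t) = 2"
    using that(1) by simp
  ultimately have "(f t)\<^sup>2 * (2 * N - t) \<le> 2"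
    by (simp only: mult.commute)
  thus ?thesis
    using that(2) by (subst pos_le_divide_eq) auto
qed

lemma deriv_square_le: "(g t)\<^sup>2 \<le> 2 / t" if "0 < t" "t \<le> 2 * N"
proof -
  have "0 \<le> (2 * N / t - 1) * (f t)\<^sup>2"
    using that by simp
  thus ?thesis
    using energy_le[OF that(1)] by linarith
qed

text \<open>Right of \<open>2 * N\<close> the derivative of \<open>f * g\<close> is a sum of two
  nonnegative terms, and \<open>f * g\<close> tends to 0. So \<open>f * g\<close> is nonpositive
  there and \<open>f^2\<close> decreases.\<close>

lemma abs_le_turning_point: "\<bar>f t\<bar> \<le> \<bar>f (2 * N)\<bar>" if "2 * N \<le> t"
proof -
  have fg: "f a * g a \<le> 0" if a: "2 * N \<le> a" for a
  proof -
    have "0 \<le> - (f a * g a)"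
    proof (rule nonneg_if_decreasing_to_0[where h = "\<lambda>s. - (f s * g s)"])
      fix s assume "a \<le> s"
      with a N_pos have s: "0 < s" "2 * N \<le> s" by linarith+
      show "((\<lambda>s. - (f s * g s)) has_real_derivative
              - ((g s)\<^sup>2 + (1 - 2 * N / s) * (f s)\<^sup>2)) (at s)"
        by (rule derivative_eq_intros deriv_f deriv_g s refl)+
          (simp add: power2_eq_square algebra_simps)
      have "0 \<le> (1 - 2 * N / s) * (f s)\<^sup>2"
        using s by simp
      thus "- ((g s)\<^sup>2 + (1 - 2 * N / s) * (f s)\<^sup>2) \<le> 0"
        using zero_le_power2[of "g s"] by linarith
    next
      show "((\<lambda>s. - (f s * g s)) \<longlongrightarrow> 0) at_top"
        using tendsto_minus[OF tendsto_mult[OF lim_f lim_g]] by simp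
    qed
    thus ?thesis by simp
  qed
  have "(f t)\<^sup>2 \<le> (f (2 * N))\<^sup>2"
  proof (rule DERIV_nonpos_imp_nonincreasing[where f = "\<lambda>x. (f x)\<^sup>2", OF that])
    fix x assume "2 * N \<le> x" "x \<le> t"
    moreover from this N_pos have "0 < x" by linarith
    hence "((\<lambda>x. (f x)\<^sup>2) has_real_derivative 2 * (f x * g x)) (at x)"
      by (auto intro!: derivative_eq_intros deriv_f)
    ultimately show "\<exists>y. ((\<lambda>x. (f x)\<^sup>2) has_real_derivative y) (at x) \<and> y \<le> 0"
      using fg[of x] by (intro exI[of _ "2 * (f x * g x)"]) auto
  qed
  thus ?thesis
    by (simp add: abs_le_square_iff)
qed

text \<open>The bound is \<open>9 / 20\<close>, just above sqrt (2 / 10), plus length 10 times slope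
  \<open>1 / 100\<close>. The threshold 20010 ensures s \<ge> 20000 on the last stretch, where sqrt
  (2 / s) \<le> 1 / 100.\<close>

lemma abs_le:
  assumes "20010 \<le> 2 * N" "0 < t"
  shows "\<bar>f t\<bar> \<le> 11 / 20"
proof -
  have far: "\<bar>f s\<bar> \<le> 9 / 20" if "0 < s" "s \<le> 2 * N - 10" for s
  proof -
    have "(f s)\<^sup>2 \<le> 2 / (2 * N - s)"
      using that by (intro square_le) auto
    also have "\<dots> \<le> 2 / 10"
      using that by (intro divide_left_mono) auto
    also have "\<dots> \<le> (9 / 20)\<^sup>2"
      by (simp add: power2_eq_square)
    finally show ?thesis
      using abs_le_square_iff[of "f s" "9 / 20"] by simp
  qed
  have g: "\<bar>g s\<bar> \<le> 1 / 100" if "2 * N - 10 \<le> s" "s \<le> 2 * N" for s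
  proof -
    have "(g s)\<^sup>2 \<le> 2 / s"
      using that assms by (intro deriv_square_le) auto
    also have "\<dots> \<le> 2 / 20000"
      using that assms by (intro divide_left_mono) auto
    also have "\<dots> = (1 / 100)\<^sup>2"
      by (simp add: power2_eq_square)
    finally show ?thesis
      using abs_le_square_iff[of "g s" "1 / 100"] by simp
  qed
  have near: "\<bar>f s\<bar> \<le> 11 / 20" if s: "2 * N - 10 \<le> s" "s \<le> 2 * N" for s
  proof -
    have "norm (f s - f (2 * N - 10)) \<le> 1 / 100 * norm (s - (2 * N - 10))"
    proof (rule field_differentiable_bound[where S = "{2 * N - 10..2 * N}" and f' = g])
      fix x assume "x \<in> {2 * N - 10..2 * N}"
      thus "(f has_real_derivative g x) (at x within {2 * N - 10..2 * N})" "norm (g x) \<le> 1 / 100"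
        using g[of x] assms by (auto intro!: has_field_derivative_at_within[OF deriv_f])
    qed (use s in auto)
    also have "\<dots> \<le> 1 / 10"
      using s by simp
    finally have "\<bar>f s - f (2 * N - 10)\<bar> \<le> 1 / 10"
      by simp
    moreover have "\<bar>f (2 * N - 10)\<bar> \<le> 9 / 20"
      using assms by (intro far) auto
    ultimately show ?thesis
      by linarith
  qed
  consider "t \<le> 2 * N - 10" | "2 * N - 10 \<le> t" "t \<le> 2 * N" | "2 * N \<le> t"
    by linarith
  thus ?thesis
  proof cases
    case 1
    thus ?thesis using far[of t] assms by simp
  next
    case 2
    thus ?thesis by (rule near)
  next
    case 3
    thus ?thesis using abs_le_turning_point[of t] near[of "2 * N"] by simp
  qed
qed

end

section \<open>Recurrences for the Bateman functions\<close>

lemma bateman_has_fps_expansion: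
  "bateman_gf t has_fps_expansion Abs_fps (\<lambda>k. of_real (bateman k t))"
proof (rule has_fps_expansionI)
  have "eventually (\<lambda>z. norm z < 1) (nhds (0::complex))"
    using eventually_nhds_in_open[of "ball 0 1" "0::complex"] by simp
  thus "eventually (\<lambda>z. (\<lambda>k. fps_nth (Abs_fps (\<lambda>k. of_real (bateman k t))) k * z ^ k)
          sums bateman_gf t z) (nhds 0)"
    by (rule eventually_mono) (simp add: bateman_sums)
qed

text \<open>The exponent has derivative \<open>- 2 * t / (1 - z)^2\<close>; clearing the denominator
  leaves polynomial coefficients, hence a finite recurrence.\<close>

lemma bateman_gf_deriv:
  assumes "norm z < 1"
  shows "(1 - z)\<^sup>2 * deriv (bateman_gf t) z = of_real (- 2 * t) * bateman_gf t z"
proof -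
  have z: "1 - z \<noteq> 0"
    using assms by auto
  have "(bateman_gf t has_field_derivative
          exp (- of_real t * ((1 + z) / (1 - z))) * (- of_real t * (2 / (1 - z)\<^sup>2))) (at z)"
    unfolding bateman_gf_def
    apply (rule derivative_eq_intros refl z)+
    using z by (simp add: field_simps power2_eq_square)
  from DERIV_imp_deriv[OF this] z show ?thesis
    by (simp add: bateman_gf_def)
qed

lemma bateman_fps_ode:
  fixes t :: real
  defines "A \<equiv> Abs_fps (\<lambda>k. of_real (bateman k t) :: complex)"
  shows "(1 - fps_X)\<^sup>2 * fps_deriv A = fps_const (of_real (- 2 * t)) * A"
proof (rule fps_expansion_unique_complex)
  have A: "bateman_gf t has_fps_expansion A"
    unfolding A_def by (rule bateman_has_fps_expansion)
  show "(\<lambda>z. (1 - z)\<^sup>2 * deriv (bateman_gf t) z)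
          has_fps_expansion (1 - fps_X)\<^sup>2 * fps_deriv A"
    by (intro fps_expansion_intros A)
  have "(\<lambda>z. of_real (- 2 * t) * bateman_gf t z)
          has_fps_expansion fps_const (of_real (- 2 * t)) * A"
    by (intro fps_expansion_intros A)
  moreover have "eventually (\<lambda>z. (1 - z)\<^sup>2 * deriv (bateman_gf t) z =
      of_real (- 2 * t) * bateman_gf t z) (nhds 0)"
    using eventually_nhds_in_open[of "ball 0 1" "0::complex"]
    by (auto elim!: eventually_mono simp: bateman_gf_deriv)
  ultimately show "(\<lambda>z. (1 - z)\<^sup>2 * deriv (bateman_gf t) z)
          has_fps_expansion fps_const (of_real (- 2 * t)) * A"
    using has_fps_expansion_cong by fast
qed

lemma bateman_0: "bateman 0 t = exp (- t)"
  by (simp add: bateman_def bateman_gf_def Re_exp)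

lemma bateman_1: "bateman (Suc 0) t = - 2 * t * exp (- t)"
proof -
  from arg_cong[OF bateman_fps_ode[of t], of "\<lambda>G. fps_nth G 0"]
  have "of_real (bateman (Suc 0) t) = (of_real (- 2 * t * bateman 0 t) :: complex)"
    by (simp add: power2_eq_square)
  thus ?thesis
    by (simp only: of_real_eq_iff bateman_0)
qed

text \<open>Compares the coefficients of z^(n+1) in the formal differential equation.\<close>

lemma bateman_rec:
  "(real n + 2) * bateman (Suc (Suc n)) t
     = (2 * (real n + 1) - 2 * t) * bateman (Suc n) t - real n * bateman n t"
proof -
  define A where "A = Abs_fps (\<lambda>k. of_real (bateman k t) :: complex)"
  have "fps_deriv A - fps_const 2 * (fps_X * fps_deriv A) + fps_X * (fps_X * fps_deriv A)
          = fps_const (of_real (- 2 * t)) * A"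
    using bateman_fps_ode[of t] unfolding A_def[symmetric]
    by (simp add: power2_eq_square algebra_simps flip: numeral_fps_const)
  from arg_cong[OF this, of "\<lambda>G. fps_nth G (Suc n)"]
  have "complex_of_real ((real n + 2) * bateman (Suc (Suc n)) t
          - 2 * (real n + 1) * bateman (Suc n) t + real n * bateman n t)
        = of_real (- 2 * t * bateman (Suc n) t)"
    \<comment> \<open>For \<open>n = 0\<close> the double shift by \<open>fps_X\<close> contributes
      0, in agreement with the factor \<open>real n\<close>.\<close>
    by (cases n) (simp_all add: A_def algebra_simps)
  hence "(real n + 2) * bateman (Suc (Suc n)) t
          - 2 * (real n + 1) * bateman (Suc n) t + real n * bateman n t
        = - 2 * t * bateman (Suc n) t"
    by (simp only: of_real_eq_iff)
  thus ?thesis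
    by (simp add: algebra_simps)
qed

text \<open>The derivative of F_n for n \<ge> 1 and t \<noteq> 0, in closed form so that calculus
  becomes algebra. At \<open>n = 0\<close> the truncated \<open>n - 1\<close> spoils it, so the
  derivative lemmas speak of \<open>Suc n\<close>.\<close>

definition bateman' :: "nat \<Rightarrow> real \<Rightarrow> real" where
  "bateman' n t = ((real n - t) * bateman n t - (real n - 1) * bateman (n - 1) t) / t"

lemma bateman'_Suc:
  "bateman' (Suc n) t = ((real n + 1 - t) * bateman (Suc n) t - real n * bateman n t) / t"
  by (simp add: bateman'_def algebra_simps)

lemma bateman'_Suc_Suc:
  "bateman' (Suc (Suc n)) t
     = ((real n + 2 - t) * bateman (Suc (Suc n)) t - (real n + 1) * bateman (Suc n) t) / t"
  unfolding bateman'_Suc by (simp add: algebra_simps)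

text \<open>Together with \<open>bateman'_Suc_Suc\<close> this expresses the derivatives of F_(n+1)
  and F_(n+2) through these same two functions.\<close>

lemma bateman'_Suc_forward:
  "bateman' (Suc n) t
     = ((real n + 2) * bateman (Suc (Suc n)) t - (real n + 1 - t) * bateman (Suc n) t) / t"
  unfolding bateman'_Suc bateman_rec by (simp add: algebra_simps)

text \<open>Differentiating the recurrence carries the formula from two consecutive indices to the
  next, starting from F_1 and F_2.\<close>

lemma bateman_deriv:
  assumes "t \<noteq> 0"
  shows "(bateman (Suc n) has_real_derivative bateman' (Suc n) t) (at t)"
proof (induction n rule: induct_nat_012)
  case 0
  have eq: "bateman (Suc 0) = (\<lambda>t. - 2 * t * exp (- t))"
    by (rule ext) (rule bateman_1)
  show ?case
    unfolding bateman'_Suc unfolding eq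
    apply (rule derivative_eq_intros refl)+
    using assms by (simp add: field_simps)
next
  case 1
  \<comment> \<open>In the recurrence at \<open>n = 0\<close> the coefficient of F_0
    vanishes.\<close>
  have eq: "bateman (Suc (Suc 0)) = (\<lambda>t. (1 - t) * (- 2 * t * exp (- t)))"
  proof
    fix t
    show "bateman (Suc (Suc 0)) t = (1 - t) * (- 2 * t * exp (- t))"
      using bateman_rec[of 0 t] by (simp add: bateman_1 algebra_simps)
  qed
  show ?case
    unfolding bateman'_Suc bateman_1 unfolding eq
    apply (rule derivative_eq_intros refl)+
    using assms by (simp add: field_simps)
next
  case (ge2 n)
  have eq: "bateman (Suc (Suc (Suc n))) = (\<lambda>t. ((2 * (real n + 2) - 2 * t) * bateman (Suc (Suc n)) t
      - (real n + 1) * bateman (Suc n) t) / (real n + 3))"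
    using bateman_rec[of "Suc n"] by (intro ext) (simp add: field_simps)
  define D where "D = ((2 * (real n + 2) - 2 * t) * bateman' (Suc (Suc n)) t
      - 2 * bateman (Suc (Suc n)) t - (real n + 1) * bateman' (Suc n) t) / (real n + 3)"
  have "(bateman (Suc (Suc (Suc n))) has_real_derivative D) (at t)"
    unfolding eq D_def
    by (rule derivative_eq_intros ge2 refl | simp)+
  moreover have "D = bateman' (Suc (Suc (Suc n))) t"
  proof -
    let ?a = "bateman (Suc n) t" and ?b = "bateman (Suc (Suc n)) t"
      and ?c = "bateman (Suc (Suc (Suc n))) t"
    \<comment> \<open>The downward form for \<open>?b\<close> and the upward form for
      \<open>?a\<close> leave only \<open>?a\<close> and \<open>?b\<close>; \<open>c\<close> then
      trades \<open>?a\<close> for \<open>?c\<close>.\<close>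
    have b: "t * bateman' (Suc (Suc n)) t = (real n + 2 - t) * ?b - (real n + 1) * ?a"
      using assms by (simp add: bateman'_Suc_Suc)
    have a: "t * bateman' (Suc n) t = (real n + 2) * ?b - (real n + 1 - t) * ?a"
      using assms by (simp add: bateman'_Suc_forward)
    have c: "(real n + 3) * ?c = (2 * (real n + 2) - 2 * t) * ?b - (real n + 1) * ?a"
      using bateman_rec[of "Suc n" t] by (simp add: algebra_simps)
    have "(real n + 3) * D = (2 * (real n + 2) - 2 * t) * bateman' (Suc (Suc n)) t
        - 2 * ?b - (real n + 1) * bateman' (Suc n) t"
      by (simp add: D_def)
    hence "t * ((real n + 3) * D) = t * ((2 * (real n + 2) - 2 * t) * bateman' (Suc (Suc n)) t
        - 2 * ?b - (real n + 1) * bateman' (Suc n) t)"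
      by (rule arg_cong)
    also have "\<dots> = (2 * (real n + 2) - 2 * t) * (t * bateman' (Suc (Suc n)) t)
        - 2 * t * ?b - (real n + 1) * (t * bateman' (Suc n) t)"
      by (simp add: algebra_simps)
    also have "\<dots> = (real n + 3 - t) * ((real n + 3) * ?c) - (real n + 3) * ((real n + 2) * ?b)"
      unfolding a b c by (simp add: algebra_simps)
    finally have "(real n + 3) * (t * D) = (real n + 3) * ((real n + 3 - t) * ?c - (real n + 2) * ?b)"
      by (simp add: algebra_simps)
    hence "t * D = (real n + 3 - t) * ?c - (real n + 2) * ?b"
      by (subst (asm) mult_left_cancel) simp_all
    thus ?thesis
      using assms by (simp add: bateman'_Suc field_simps)
  qed
  ultimately show ?case by simp
qed

text \<open>Differentiate the upward form, then insert the upward form for F_(n+1)' and the downward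
  form for F_(n+2)': all terms in F_(n+2) cancel.\<close>

lemma bateman'_deriv:
  assumes "t \<noteq> 0"
  shows "(bateman' (Suc n) has_real_derivative (1 - 2 * real (Suc n) / t) * bateman (Suc n) t) (at t)"
proof -
  let ?b = "bateman (Suc n) t" and ?c = "bateman (Suc (Suc n)) t"
  have eq: "bateman' (Suc n) = (\<lambda>t. ((real n + 2) * bateman (Suc (Suc n)) t
      - (real n + 1 - t) * bateman (Suc n) t) / t)"
    by (rule ext) (rule bateman'_Suc_forward)
  have c: "bateman' (Suc (Suc n)) t = ((real n + 2 - t) * ?c - (real n + 1) * ?b) / t"
    by (rule bateman'_Suc_Suc)
  show ?thesis
    apply (subst eq)
    apply (rule derivative_eq_intros bateman_deriv assms refl)+
    unfolding c unfolding bateman'_Suc_forward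
    using assms by (simp add: field_simps power2_eq_square)
qed

section \<open>Decay and mass\<close>

lemma tendsto_exp_poly_at_top: "((\<lambda>t::real. exp (- t) * poly q t) \<longlongrightarrow> 0) at_top"
proof -
  have "((\<lambda>t. \<Sum>i\<le>degree q. coeff q i * (t ^ i / exp t)) \<longlongrightarrow>
          (\<Sum>i\<le>degree q. coeff q i * 0)) at_top"
    by (intro tendsto_intros tendsto_power_div_exp_0)
  thus ?thesis
    by (simp add: poly_altdef sum_distrib_left exp_minus field_simps)
qed

text \<open>Up to a constant, \<open>poly q t\<close> is the Laguerre polynomial L_n^(1)(2 t). The
  exponential gives decay; the explicit factor \<open>t\<close> controls quotients by
  \<open>t\<close> near 0.\<close>

lemma bateman_exp_poly: "\<exists>q. \<forall>t. bateman (Suc n) t = t * (exp (- t) * poly q t)"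
proof (induction n rule: induct_nat_012)
  case 0
  show ?case
    by (rule exI[of _ "[:-2:]"]) (simp add: bateman_1)
next
  case 1
  have "bateman (Suc (Suc 0)) t = (1 - t) * bateman (Suc 0) t" for t
    using bateman_rec[of 0 t] by (simp add: algebra_simps)
  thus ?case
    by (intro exI[of _ "[:-2, 2:]"]) (simp add: bateman_1 algebra_simps)
next
  case (ge2 n)
  then obtain q r where
    q: "\<And>t. bateman (Suc n) t = t * (exp (- t) * poly q t)" and
    r: "\<And>t. bateman (Suc (Suc n)) t = t * (exp (- t) * poly r t)"
    by blast
  have "bateman (Suc (Suc (Suc n))) t = ((2 * (real n + 2) - 2 * t) * bateman (Suc (Suc n)) t
      - (real n + 1) * bateman (Suc n) t) / (real n + 3)" for t
    using bateman_rec[of "Suc n" t] by (simp add: field_simps)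
  thus ?case
    by (intro exI[of _ "smult (1 / (real n + 3))
        ([:2 * (real n + 2), -2:] * r - smult (real n + 1) q)"])
      (simp add: q r field_simps)
qed

lemma bateman_tendsto: "(bateman n \<longlongrightarrow> 0) at_top"
proof (cases n)
  case 0
  thus ?thesis
    using tendsto_exp_poly_at_top[of 1] by (simp add: bateman_0[abs_def])
next
  case (Suc m)
  obtain q where "\<And>t. bateman (Suc m) t = t * (exp (- t) * poly q t)"
    using bateman_exp_poly by blast
  hence "bateman n = (\<lambda>t. exp (- t) * poly (pCons 0 q) t)"
    by (simp add: Suc fun_eq_iff)
  thus ?thesis
    using tendsto_exp_poly_at_top[of "pCons 0 q"] by simp
qed

lemma bateman'_tendsto: "(bateman' n \<longlongrightarrow> 0) at_top"
proof -
  have inv: "((\<lambda>s::real. 1 / s) \<longlongrightarrow> 0) at_top"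
    by (simp add: divide_inverse tendsto_inverse_0_at_top filterlim_ident)
  have "((\<lambda>t. (real n * bateman n t - (real n - 1) * bateman (n - 1) t) * (1 / t) - bateman n t)
          \<longlongrightarrow> (real n * 0 - (real n - 1) * 0) * 0 - 0) at_top"
    by (intro tendsto_intros bateman_tendsto inv)
  moreover have "eventually (\<lambda>t. (real n * bateman n t - (real n - 1) * bateman (n - 1) t) * (1 / t)
      - bateman n t = bateman' n t) at_top"
    using eventually_gt_at_top[of 0]
    by eventually_elim (simp add: bateman'_def field_simps)
  ultimately show ?thesis
    by (simp add: tendsto_cong)
qed

text \<open>
  Here \<open>P\<close> is \<open>n \<integral> F\<^sub>n\<^sup>2 / s ds\<close> over \<open>(t, \<infinity>)\<close>, built without integrals. The induction
  works because \<open>n F\<^sub>n\<^sup>2 / t - (n + 1) F\<^sub>n\<^sub>+\<^sub>1\<^sup>2 / t\<close> is the derivative of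
  \<open>V = (W - 2 F\<^sub>n F\<^sub>n\<^sub>+\<^sub>1) / 2\<close>, where \<open>W = F\<^sub>n' F\<^sub>n\<^sub>+\<^sub>1 - F\<^sub>n F\<^sub>n\<^sub>+\<^sub>1'\<close> is the Wronskian. In closed form,
  \<open>V = (F\<^sub>n\<^sub>+\<^sub>1 - F\<^sub>n) ((n + 1) F\<^sub>n\<^sub>+\<^sub>1 - n F\<^sub>n) / (2 t)\<close>, which vanishes at both ends.
\<close>

lemma bateman_mass:
  "\<exists>P. (\<forall>t>0. (P has_real_derivative - (real (Suc n) * (bateman (Suc n) t)\<^sup>2 / t)) (at t))
      \<and> (P \<longlongrightarrow> 0) at_top \<and> (P \<longlongrightarrow> 1) (at_right 0)"
proof (induction n)
  case 0
  \<comment> \<open>The integral of 4 s exp (- 2 s) over s > t, from F_1(s) = - 2 s exp (-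
    s).\<close>
  let ?P = "\<lambda>t::real. (1 + 2 * t) * exp (- (2 * t))"
  have "(?P has_real_derivative - (real (Suc 0) * (bateman (Suc 0) t)\<^sup>2 / t)) (at t)" if "0 < t" for t
    apply (rule derivative_eq_intros refl)+
    using that by (simp add: bateman_1 field_simps power2_eq_square flip: exp_add)
  moreover have "(?P \<longlongrightarrow> 0) at_top"
    using tendsto_mult[OF tendsto_exp_poly_at_top[of "[:1, 2:]"] tendsto_exp_poly_at_top[of 1]]
    by (simp add: algebra_simps flip: exp_add)
  moreover have "(?P \<longlongrightarrow> (1 + 2 * 0) * exp (- (2 * 0))) (at_right 0)"
    by (intro tendsto_intros)
  hence "(?P \<longlongrightarrow> 1) (at_right 0)"
    by simp
  ultimately show ?case by blast
next
  case (Suc n)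
  then obtain P where
    P: "\<And>t. 0 < t \<Longrightarrow> (P has_real_derivative - (real (Suc n) * (bateman (Suc n) t)\<^sup>2 / t)) (at t)"
      "(P \<longlongrightarrow> 0) at_top" "(P \<longlongrightarrow> 1) (at_right 0)"
    by blast
  let ?b = "bateman (Suc n)" and ?c = "bateman (Suc (Suc n))"
  define V where "V t = (?c t - ?b t) * ((real n + 2) * ?c t - (real n + 1) * ?b t) / (2 * t)" for t
  have deriv_V: "(V has_real_derivative
      ((real n + 1) * (?b t)\<^sup>2 - (real n + 2) * (?c t)\<^sup>2) / t) (at t)" if "0 < t" for t
  proof -
    have b': "bateman' (Suc n) t = ((real n + 2) * ?c t - (real n + 1 - t) * ?b t) / t"
      by (rule bateman'_Suc_forward)
    have c': "bateman' (Suc (Suc n)) t = ((real n + 2 - t) * ?c t - (real n + 1) * ?b t) / t"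
      by (rule bateman'_Suc_Suc)
    have t: "t \<noteq> 0" "2 * t \<noteq> 0"
      using that by auto
    show ?thesis
      unfolding V_def
      apply (rule derivative_eq_intros bateman_deriv t refl)+
      unfolding c' unfolding b' using that by (simp add: field_simps power2_eq_square)
  qed
  obtain q r where
    q: "\<And>t. ?b t = t * (exp (- t) * poly q t)" and r: "\<And>t. ?c t = t * (exp (- t) * poly r t)"
    using bateman_exp_poly by meson
  \<comment> \<open>Of the two factors \<open>t\<close> in the numerator of \<open>V\<close>, one
    survives the division by \<open>2 * t\<close>. It goes into \<open>u\<close>, so
    \<open>poly u 0 = 0\<close> and \<open>V\<close> vanishes at 0.\<close>
  define u where "u = pCons 0 (r - q)"
  define v where "v = smult (1 / 2) (smult (real n + 2) r - smult (real n + 1) q)"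
  have V: "V t = (exp (- t) * poly u t) * (exp (- t) * poly v t)" for t
    \<comment> \<open>Division by zero gives \<open>V 0 = 0\<close>, which agrees with
      \<open>poly u 0 = 0\<close>.\<close>
    by (cases "t = 0") (simp_all add: V_def q r u_def v_def field_simps)
  have "(V \<longlongrightarrow> 0) at_top"
    using tendsto_mult[OF tendsto_exp_poly_at_top[of u] tendsto_exp_poly_at_top[of v]]
    by (simp add: V[abs_def])
  moreover have "(V \<longlongrightarrow> 0) (at_right 0)"
  proof -
    have "(V \<longlongrightarrow> (exp (- 0) * poly u 0) * (exp (- 0) * poly v 0)) (at_right 0)"
      unfolding V[abs_def] by (intro tendsto_intros)
    thus ?thesis by (simp add: u_def)
  qed
  moreover have "((\<lambda>t. P t + V t) has_real_derivative
      - (real (Suc (Suc n)) * (?c t)\<^sup>2 / t)) (at t)" if "0 < t" for t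
    apply (rule derivative_eq_intros P(1) deriv_V that refl)+
    using that by (simp add: field_simps)
  ultimately show ?case
    using tendsto_add[OF P(2), of V 0] tendsto_add[OF P(3), of V 0]
    by (intro exI[of _ "\<lambda>t. P t + V t"]) simp
qed

section \<open>The uniform bound for large index and the conclusion\<close>

lemma abs_bateman_le:
  assumes "10005 \<le> n" "0 < t"
  shows "\<bar>bateman n t\<bar> \<le> 11 / 20"
proof -
  obtain m where n: "n = Suc m"
    using assms by (cases n) auto
  obtain P where
    "\<forall>t>0. (P has_real_derivative - (real n * (bateman n t)\<^sup>2 / t)) (at t)"
    "(P \<longlongrightarrow> 0) at_top" "(P \<longlongrightarrow> 1) (at_right 0)"
    unfolding n using bateman_mass by blast
  then interpret whittaker_mass "bateman n" "bateman' n" P "real n"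
    by unfold_locales
      (simp_all add: n bateman_deriv bateman'_deriv bateman_tendsto bateman'_tendsto del: of_nat_Suc)
  show ?thesis
    using assms by (intro abs_le) auto
qed

theorem theorem5:
  assumes "\<And>(n::nat) (t::real). 1 \<le> n \<Longrightarrow> n \<le> 21138 \<Longrightarrow> 0 < t \<Longrightarrow> \<bar>bateman n t\<bar> \<le> 2 / exp 1"
  shows "\<forall>n::nat. \<forall>t::real. 1 \<le> n \<longrightarrow> 0 < t \<longrightarrow> \<bar>bateman n t\<bar> \<le> 2 / exp 1"
proof (intro allI impI)
  fix n :: nat and t :: real
  assume n: "1 \<le> n" and t: "0 < t"
  show "\<bar>bateman n t\<bar> \<le> 2 / exp 1"
  proof (cases "n \<le> 21138")
    case True
    thus ?thesis using assms n t by blast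
  next
    case False
    hence "\<bar>bateman n t\<bar> \<le> 11 / 20"
      using t by (intro abs_bateman_le) auto
    also have "\<dots> \<le> 2 / exp 1"
      \<comment> \<open>From e < 2.72 one gets 2 / e > 0.73, above 11 / 20 = 0.55.\<close>
      using e_less_272 by (simp add: field_simps)
    finally show ?thesis .
  qed
qed

end
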